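(* If $L$ is a finite distributive lattice, then $D(L)=1$ if and only if $D(Q_L)=1$.
   Context: A point of a lattice is join-irreducible if in the Hasse diagram it has exactly one downward edge; $Q_L$ is the subposet induced by the join-irreducible points of $L$. A coloring of a poset is distinguishing if the only color-preserving automorphism is the identity; $D(P)$ is the least number of colors in a distinguishing coloring of $P$. *)

theory Defs imports Main begin

text \<open>Posets are sets \<open>A\<close> in a type of class \<^class>\<open>order\<close>, carrying the induced order.\<close>

definition poset_automorphism :: "'a::order set \<Rightarrow> ('a \<Rightarrow> 'a) \<Rightarrow> bool" where
  "poset_automorphism A f \<longleftrightarrow>
     bij_betw f A A \<and> (\<forall>x\<in>A. \<forall>y\<in>A. x \<le> y \<longleftrightarrow> f x \<le> f y)"

definition distinguishing_coloring :: "'a::order set \<Rightarrow> ('a \<Rightarrow> 'c) \<Rightarrow> bool" where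
  "distinguishing_coloring A c \<longleftrightarrow>
     (\<forall>f. poset_automorphism A f \<and> (\<forall>x\<in>A. c (f x) = c x) \<longrightarrow> (\<forall>x\<in>A. f x = x))"

text \<open>
  The palette \<open>{1..k}\<close> is required to be nonempty, so that the empty poset has
  distinguishing number 1; it arises as the poset of join-irreducibles of the
  one-element lattice. For nonempty \<open>A\<close> the condition \<open>1 \<le> k\<close> is redundant.
\<close>

definition distinguishing_number :: "'a::order set \<Rightarrow> nat" where
  "distinguishing_number A =
     (LEAST k. 1 \<le> k \<and> (\<exists>c. c ` A \<subseteq> {1..k} \<and> distinguishing_coloring A c))"

text \<open>The minimum is attained on finite posets.\<close>

lemma distinguishing_number_witness:
  fixes A :: "'a::order set"
  assumes "finite A"
  shows "1 \<le> distinguishing_number A \<and>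
    (\<exists>c. c ` A \<subseteq> {1..distinguishing_number A} \<and> distinguishing_coloring A c)"
proof -
  obtain h where h: "bij_betw h A {0..<card A}"
    using ex_bij_betw_finite_nat[OF assms] by blast
  define c where "c = Suc \<circ> h"
  have inj: "inj_on c A"
    using h by (auto simp: c_def bij_betw_def intro: comp_inj_on)
  have "c ` A \<subseteq> {1..Suc (card A)}"
    using bij_betwE[OF h] by (auto simp: c_def less_imp_le)
  moreover have "distinguishing_coloring A c"
    using inj by (auto simp: distinguishing_coloring_def poset_automorphism_def
        dest: bij_betwE inj_onD)
  ultimately have "1 \<le> Suc (card A) \<and>
      (\<exists>c. c ` A \<subseteq> {1..Suc (card A)} \<and> distinguishing_coloring A c)"
    by auto
  then show ?thesis
    unfolding distinguishing_number_def by (rule LeastI)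
qed

definition covered_by :: "'a::order \<Rightarrow> 'a \<Rightarrow> bool" where
  "covered_by y x \<longleftrightarrow> y < x \<and> \<not> (\<exists>z. y < z \<and> z < x)"

text \<open>Exactly one downward edge in the Hasse diagram; in particular the bottom element is excluded.\<close>

definition join_irreducible :: "'a::lattice \<Rightarrow> bool" where
  "join_irreducible x \<longleftrightarrow> (\<exists>!y. covered_by y x)"

definition join_irreducibles :: "'a::lattice set" where
  "join_irreducibles = {x. join_irreducible x}"

end

theory Submission imports Defs begin

text \<open>
  A finite poset has distinguishing number 1 exactly when it is rigid, so the claim is that
  \<open>L\<close> is rigid if and only if \<open>Q\<^sub>L\<close> is. An automorphism of \<open>L\<close> preserves covers, so it restricts
  to \<open>Q\<^sub>L\<close>, and it is determined by this restriction because every element is determined by the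
  join-irreducibles below it. Conversely, by Birkhoff's theorem \<open>L\<close> is isomorphic to the lattice
  of down-sets of \<open>Q\<^sub>L\<close>, on which every automorphism of \<open>Q\<^sub>L\<close> acts by taking images.
\<close>

definition poset_isomorphism :: "'a::order set \<Rightarrow> 'b::order set \<Rightarrow> ('a \<Rightarrow> 'b) \<Rightarrow> bool" where
  "poset_isomorphism A B f \<longleftrightarrow>
     bij_betw f A B \<and> (\<forall>x\<in>A. \<forall>y\<in>A. x \<le> y \<longleftrightarrow> f x \<le> f y)"

lemma poset_automorphism_iff_isomorphism:
  "poset_automorphism A f \<longleftrightarrow> poset_isomorphism A A f"
  by (simp add: poset_automorphism_def poset_isomorphism_def)

lemma poset_isomorphism_bij_betw: "poset_isomorphism A B f \<Longrightarrow> bij_betw f A B"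
  by (simp add: poset_isomorphism_def)

lemma poset_isomorphism_le_iff:
  "poset_isomorphism A B f \<Longrightarrow> x \<in> A \<Longrightarrow> y \<in> A \<Longrightarrow> f x \<le> f y \<longleftrightarrow> x \<le> y"
  by (simp add: poset_isomorphism_def)

lemma poset_isomorphism_less_iff:
  "poset_isomorphism A B f \<Longrightarrow> x \<in> A \<Longrightarrow> y \<in> A \<Longrightarrow> f x < f y \<longleftrightarrow> x < y"
  by (simp add: less_le_not_le poset_isomorphism_le_iff)

lemma poset_isomorphism_comp:
  assumes "poset_isomorphism A B f" "poset_isomorphism B C g"
  shows "poset_isomorphism A C (g \<circ> f)"
  using assms bij_betw_trans[of f A B g C]
  by (auto simp: poset_isomorphism_def bij_betw_apply)

lemma poset_isomorphism_inv_into: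
  assumes "poset_isomorphism A B f"
  shows "poset_isomorphism B A (inv_into A f)"
  using assms bij_betw_inv_into[of f A B]
  by (auto simp: poset_isomorphism_def bij_betw_apply bij_betw_inv_into_right)

lemma poset_isomorphism_subset:
  assumes "poset_isomorphism A B f" "S \<subseteq> A"
  shows "poset_isomorphism S (f ` S) f"
  using assms by (auto simp: poset_isomorphism_def intro: bij_betw_subset)

lemma poset_isomorphism_image_Collect_le:
  assumes "poset_isomorphism A B f" "S \<subseteq> A" "x \<in> A"
  shows "f ` {y \<in> S. y \<le> x} = {z \<in> f ` S. z \<le> f x}"
  using assms by (auto simp: poset_isomorphism_le_iff subset_iff)

definition rigid :: "'a::order set \<Rightarrow> bool" where
  "rigid A \<longleftrightarrow> (\<forall>f. poset_automorphism A f \<longrightarrow> (\<forall>x\<in>A. f x = x))"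

lemma distinguishing_coloring_constant_iff_rigid:
  assumes "c ` A \<subseteq> {k}"
  shows "distinguishing_coloring A c \<longleftrightarrow> rigid A"
proof -
  have "c (f x) = c x" if "poset_automorphism A f" "x \<in> A" for f x
    using that assms by (auto simp: poset_automorphism_def image_subset_iff dest: bij_betwE)
  then show ?thesis
    unfolding distinguishing_coloring_def rigid_def by blast
qed

lemma distinguishing_number_eq_1_iff_rigid:
  fixes A :: "'a::order set"
  assumes "finite A"
  shows "distinguishing_number A = 1 \<longleftrightarrow> rigid A"
proof
  assume "distinguishing_number A = 1"
  then obtain c :: "'a \<Rightarrow> nat" where "c ` A \<subseteq> {1}" "distinguishing_coloring A c"
    using distinguishing_number_witness[OF assms] by auto
  then show "rigid A"
    by (simp only: distinguishing_coloring_constant_iff_rigid)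
next
  assume "rigid A"
  then have "distinguishing_coloring A (\<lambda>_. 1::nat)"
    by (subst distinguishing_coloring_constant_iff_rigid[where k = 1]) auto
  then show "distinguishing_number A = 1"
    unfolding distinguishing_number_def by (intro Least_equality) auto
qed

definition downsets :: "'a::order set \<Rightarrow> 'a set set" where
  "downsets P = {S. S \<subseteq> P \<and> (\<forall>y\<in>S. \<forall>x\<in>P. x \<le> y \<longrightarrow> x \<in> S)}"

lemma image_in_downsets:
  assumes f: "poset_isomorphism P Q f" and S: "S \<in> downsets P"
  shows "f ` S \<in> downsets Q"
proof -
  have "S \<subseteq> P" and closed: "\<And>x y. y \<in> S \<Longrightarrow> x \<in> P \<Longrightarrow> x \<le> y \<Longrightarrow> x \<in> S"
    using S by (auto simp: downsets_def)
  have Q: "Q = f ` P"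
    using poset_isomorphism_bij_betw[OF f] by (simp add: bij_betw_imp_surj_on)
  have "f x \<in> f ` S" if "y \<in> S" "x \<in> P" "f x \<le> f y" for x y
    using that closed \<open>S \<subseteq> P\<close> poset_isomorphism_le_iff[OF f] by blast
  with \<open>S \<subseteq> P\<close> show ?thesis
    by (auto simp: downsets_def Q)
qed

lemma poset_isomorphism_downsets:
  assumes f: "poset_isomorphism P Q f"
  shows "poset_isomorphism (downsets P) (downsets Q) ((`) f)"
proof -
  have bij: "bij_betw f P Q"
    using f by (rule poset_isomorphism_bij_betw)
  have "bij_betw ((`) f) (Pow P) (Pow Q)"
    using bij by (rule bij_betw_Pow)
  moreover have "S \<subseteq> T \<longleftrightarrow> f ` S \<subseteq> f ` T" if "S \<subseteq> P" "T \<subseteq> P" for S T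
    using that bij by (metis bij_betw_imp_inj_on image_mono inv_into_image_cancel)
  ultimately have "poset_isomorphism (Pow P) (Pow Q) ((`) f)"
    by (simp add: poset_isomorphism_def)
  then have "poset_isomorphism (downsets P) ((`) f ` downsets P) ((`) f)"
    by (rule poset_isomorphism_subset) (auto simp: downsets_def)
  moreover have "(`) f ` downsets P = downsets Q"
  proof (intro subset_antisym subsetI)
    fix T assume T: "T \<in> downsets Q"
    then have "f ` inv_into P f ` T = T"
      using bij by (intro image_inv_into_cancel) (auto simp: downsets_def bij_betw_def)
    then show "T \<in> (`) f ` downsets P"
      using image_in_downsets[OF poset_isomorphism_inv_into[OF f] T] by (metis imageI)
  qed (auto intro: image_in_downsets[OF f])
  ultimately show ?thesis
    by simp
qed

lemma ex_covered_by_above: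
  fixes x y :: "'a::order"
  assumes "y < x" "finite {y..<x}"
  obtains z where "y \<le> z" "covered_by z x"
proof -
  obtain z where z: "y \<le> z" "z < x" and max: "\<And>w. y \<le> w \<Longrightarrow> w < x \<Longrightarrow> z \<le> w \<Longrightarrow> z = w"
    using finite_has_maximal2[of "{y..<x}" y] assms by auto
  have "covered_by z x"
    unfolding covered_by_def using z max by (metis less_le order_trans)
  with z that show ?thesis by blast
qed

lemma join_irreducible_iff_greatest_below:
  fixes j :: "'a::lattice"
  assumes "finite {..<j}"
  shows "join_irreducible j \<longleftrightarrow> (\<exists>c<j. \<forall>x<j. x \<le> c)"
proof
  assume "join_irreducible j"
  then obtain c where c: "covered_by c j" and unique: "\<And>d. covered_by d j \<Longrightarrow> d = c"
    unfolding join_irreducible_def by blast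
  have "x \<le> c" if "x < j" for x
  proof -
    have "finite {x..<j}"
      using assms by (rule finite_subset[rotated]) auto
    with \<open>x < j\<close> obtain d where "x \<le> d" "covered_by d j"
      by (rule ex_covered_by_above)
    with unique show ?thesis by blast
  qed
  with c show "\<exists>c<j. \<forall>x<j. x \<le> c"
    by (auto simp: covered_by_def)
next
  assume "\<exists>c<j. \<forall>x<j. x \<le> c"
  then obtain c where c: "c < j" and greatest: "\<And>x. x < j \<Longrightarrow> x \<le> c"
    by blast
  have "covered_by d j \<longleftrightarrow> d = c" for d
    using c greatest by (auto simp: covered_by_def less_le_not_le intro: order_antisym)
  then show "join_irreducible j"
    by (simp add: join_irreducible_def)
qed

lemma join_irreducible_le_sup_iff:
  fixes j a b :: "'a::distrib_lattice"
  assumes "join_irreducible j" "finite {..<j}"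
  shows "j \<le> sup a b \<longleftrightarrow> j \<le> a \<or> j \<le> b"
proof
  assume le: "j \<le> sup a b"
  obtain c where c: "c < j" and greatest: "\<And>x. x < j \<Longrightarrow> x \<le> c"
    using assms join_irreducible_iff_greatest_below by blast
  show "j \<le> a \<or> j \<le> b"
  proof (rule ccontr)
    assume "\<not> (j \<le> a \<or> j \<le> b)"
    then have "inf j a < j" "inf j b < j"
      by (auto simp: less_le_not_le)
    then have "sup (inf j a) (inf j b) \<le> c"
      by (simp add: greatest)
    moreover have "sup (inf j a) (inf j b) = j"
      using le by (simp add: inf_sup_distrib1[symmetric] inf.absorb1)
    ultimately show False
      using c by simp
  qed
qed (auto intro: le_supI1 le_supI2)

lemma join_irreducible_le_Sup_fin_iff:
  fixes j :: "'a::distrib_lattice"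
  assumes "join_irreducible j" "finite {..<j}" "finite S" "S \<noteq> {}"
  shows "j \<le> Sup_fin S \<longleftrightarrow> (\<exists>s\<in>S. j \<le> s)"
  using assms(3,4)
  by (induction S rule: finite_ne_induct)
    (simp_all add: join_irreducible_le_sup_iff[OF assms(1,2)])

lemma ex_join_irreducible_separating:
  fixes x y :: "'a::lattice"
  assumes "\<not> x \<le> y" "finite {..x}"
  obtains j where "join_irreducible j" "j \<le> x" "\<not> j \<le> y"
proof -
  obtain j where j: "j \<le> x" "\<not> j \<le> y"
    and min: "\<And>z. z \<le> x \<Longrightarrow> \<not> z \<le> y \<Longrightarrow> z \<le> j \<Longrightarrow> j = z"
    using finite_has_minimal2[of "{..x} - {..y}" x] assms by auto
  have "z \<le> inf j y" if "z < j" for z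
  proof -
    have "z \<le> j" "z \<noteq> j"
      using that by auto
    with min[of z] j(1) show ?thesis
      by (auto intro: order_trans)
  qed
  moreover have "inf j y < j"
    using j(2) by (auto simp: less_le_not_le)
  moreover have "finite {..<j}"
    using assms(2) j(1) by (auto elim!: finite_subset[rotated])
  ultimately have "join_irreducible j"
    by (auto simp: join_irreducible_iff_greatest_below)
  with j that show ?thesis by blast
qed

definition irreducibles_below :: "'a::lattice \<Rightarrow> 'a set" where
  "irreducibles_below x = {j \<in> join_irreducibles. j \<le> x}"

lemma irreducibles_below_subset_iff:
  fixes x y :: "'a::lattice"
  assumes "finite {..x}"
  shows "irreducibles_below x \<subseteq> irreducibles_below y \<longleftrightarrow> x \<le> y"
proof
  assume sub: "irreducibles_below x \<subseteq> irreducibles_below y"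
  show "x \<le> y"
  proof (rule ccontr)
    assume "\<not> x \<le> y"
    then obtain j where "join_irreducible j" "j \<le> x" "\<not> j \<le> y"
      using assms by (rule ex_join_irreducible_separating)
    with sub show False
      by (auto simp: irreducibles_below_def join_irreducibles_def)
  qed
qed (auto simp: irreducibles_below_def)

lemma inj_irreducibles_below: "inj (irreducibles_below :: 'a::{finite, lattice} \<Rightarrow> 'a set)"
  by (intro injI order_antisym) (simp_all flip: irreducibles_below_subset_iff)

lemma irreducibles_below_least:
  assumes "\<And>y. x \<le> y"
  shows "irreducibles_below x = {}"
proof -
  have "\<not> covered_by c j" if "j \<le> x" for c j
    using that assms[of c] by (auto simp: covered_by_def)
  then show ?thesis
    by (auto simp: irreducibles_below_def join_irreducibles_def join_irreducible_def)
qed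

lemma irreducibles_below_Sup_fin:
  fixes S :: "'a::{finite, distrib_lattice} set"
  assumes "S \<in> downsets join_irreducibles" "S \<noteq> {}"
  shows "irreducibles_below (Sup_fin S) = S"
proof -
  have "irreducibles_below (Sup_fin S) = {j \<in> join_irreducibles. \<exists>s\<in>S. j \<le> s}"
    using assms(2)
    by (simp add: irreducibles_below_def join_irreducibles_def join_irreducible_le_Sup_fin_iff
        cong: conj_cong)
  also have "\<dots> = S"
    using assms(1) by (auto simp: downsets_def)
  finally show ?thesis .
qed

theorem Birkhoff_representation:
  "poset_isomorphism UNIV (downsets join_irreducibles)
     (irreducibles_below :: 'a::{finite, distrib_lattice} \<Rightarrow> 'a set)"
proof -
  have "irreducibles_below x \<in> downsets join_irreducibles" for x :: 'a
    by (auto simp: irreducibles_below_def downsets_def)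
  moreover have "S \<in> range irreducibles_below"
    if S: "S \<in> downsets join_irreducibles" for S :: "'a set"
  proof (cases "S = {}")
    case True
    have "irreducibles_below (Inf_fin (UNIV :: 'a set)) = {}"
      by (rule irreducibles_below_least) (simp add: Inf_fin.coboundedI)
    with True show ?thesis by blast
  next
    case False
    with S show ?thesis
      by (metis irreducibles_below_Sup_fin rangeI)
  qed
  ultimately have "range irreducibles_below = downsets (join_irreducibles :: 'a set)"
    by blast
  then show ?thesis
    by (simp add: poset_isomorphism_def bij_betw_def inj_irreducibles_below
        irreducibles_below_subset_iff)
qed

lemma poset_isomorphism_covered_by_iff:
  assumes "poset_isomorphism UNIV UNIV f"
  shows "covered_by (f y) (f x) \<longleftrightarrow> covered_by y x"
proof -
  have less: "f a < f b \<longleftrightarrow> a < b" for a b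
    using assms by (simp add: poset_isomorphism_less_iff)
  have "surj f"
    using poset_isomorphism_bij_betw[OF assms] by (rule bij_is_surj)
  then have "(\<exists>z. f y < z \<and> z < f x) \<longleftrightarrow> (\<exists>z. f y < f z \<and> f z < f x)"
    by (metis surjD)
  then show ?thesis
    by (simp add: covered_by_def less)
qed

lemma poset_isomorphism_join_irreducible_iff:
  assumes "poset_isomorphism UNIV UNIV f"
  shows "join_irreducible (f x) \<longleftrightarrow> join_irreducible x"
proof -
  have "bij f"
    using assms by (rule poset_isomorphism_bij_betw)
  have "f ` {y. covered_by y x} = {y. covered_by y (f x)}"
    using bij_is_surj[OF \<open>bij f\<close>]
    by (force simp: poset_isomorphism_covered_by_iff[OF assms] dest: surjD)
  moreover have "is_singleton (f ` {y. covered_by y x}) \<longleftrightarrow> is_singleton {y. covered_by y x}"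
    using bij_is_inj[OF \<open>bij f\<close>]
    by (simp add: is_singleton_altdef card_image inj_on_subset)
  ultimately show ?thesis
    by (simp add: join_irreducible_def is_singleton_iff_ex1)
qed

lemma poset_isomorphism_image_join_irreducibles:
  assumes "poset_isomorphism UNIV UNIV f"
  shows "f ` join_irreducibles = join_irreducibles"
proof -
  have "join_irreducibles = f -` join_irreducibles"
    by (auto simp: join_irreducibles_def poset_isomorphism_join_irreducible_iff[OF assms])
  then show ?thesis
    using poset_isomorphism_bij_betw[OF assms] by (metis bij_is_surj surj_image_vimage_eq)
qed

lemma poset_isomorphism_restrict_join_irreducibles:
  assumes "poset_isomorphism UNIV UNIV f"
  shows "poset_isomorphism join_irreducibles join_irreducibles f"
  using poset_isomorphism_subset[OF assms, of join_irreducibles]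
  by (simp add: poset_isomorphism_image_join_irreducibles[OF assms])

lemma irreducibles_below_isomorphism:
  assumes "poset_isomorphism UNIV UNIV f"
  shows "irreducibles_below (f x) = f ` irreducibles_below x"
  using poset_isomorphism_image_Collect_le[OF assms, of join_irreducibles x]
  by (simp add: irreducibles_below_def poset_isomorphism_image_join_irreducibles[OF assms])

lemma poset_isomorphism_eqI_join_irreducibles:
  fixes f g :: "'a::lattice \<Rightarrow> 'b::{finite, lattice}"
  assumes f: "poset_isomorphism UNIV UNIV f" and g: "poset_isomorphism UNIV UNIV g"
    and eq: "\<And>j. j \<in> join_irreducibles \<Longrightarrow> f j = g j"
  shows "f = g"
proof
  fix x
  have "irreducibles_below (f x) = f ` irreducibles_below x"
    using f by (rule irreducibles_below_isomorphism)
  also have "\<dots> = g ` irreducibles_below x"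
    using eq by (auto simp: irreducibles_below_def intro: image_cong)
  also have "\<dots> = irreducibles_below (g x)"
    using g by (rule irreducibles_below_isomorphism[symmetric])
  finally show "f x = g x"
    by (rule injD[OF inj_irreducibles_below])
qed

lemma poset_isomorphism_join_irreducibles_extends:
  fixes g :: "'a::{finite, distrib_lattice} \<Rightarrow> 'b::{finite, distrib_lattice}"
  assumes g: "poset_isomorphism join_irreducibles join_irreducibles g"
  obtains f where "poset_isomorphism UNIV UNIV f" "\<And>j. j \<in> join_irreducibles \<Longrightarrow> f j = g j"
proof
  let ?f = "inv irreducibles_below \<circ> ((`) g \<circ> irreducibles_below)"
  show "poset_isomorphism UNIV UNIV ?f"
    by (rule poset_isomorphism_comp[OF poset_isomorphism_comp[OF Birkhoff_representation
          poset_isomorphism_downsets[OF g]] poset_isomorphism_inv_into[OF Birkhoff_representation]])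
  show "?f j = g j" if "j \<in> join_irreducibles" for j
  proof -
    have "g ` irreducibles_below j = irreducibles_below (g j)"
      using poset_isomorphism_image_Collect_le[OF g subset_refl that]
        bij_betw_imp_surj_on[OF poset_isomorphism_bij_betw[OF g]]
      by (simp add: irreducibles_below_def)
    then show ?thesis
      by (simp add: inj_irreducibles_below)
  qed
qed

lemma rigid_UNIV_iff_rigid_join_irreducibles:
  "rigid (UNIV :: 'a::{finite, distrib_lattice} set) \<longleftrightarrow> rigid (join_irreducibles :: 'a set)"
proof
  assume rigid: "rigid (UNIV :: 'a set)"
  show "rigid (join_irreducibles :: 'a set)"
    unfolding rigid_def poset_automorphism_iff_isomorphism
  proof (intro allI impI ballI)
    fix g :: "'a \<Rightarrow> 'a" and j :: 'a
    assume g: "poset_isomorphism join_irreducibles join_irreducibles g"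
      and j: "j \<in> join_irreducibles"
    obtain f :: "'a \<Rightarrow> 'a" where f: "poset_isomorphism UNIV UNIV f"
      and extends: "\<And>i. i \<in> join_irreducibles \<Longrightarrow> f i = g i"
      using g by (rule poset_isomorphism_join_irreducibles_extends) blast
    have "f j = j"
      using f rigid by (simp add: rigid_def poset_automorphism_iff_isomorphism)
    then show "g j = j"
      using extends[OF j] by simp
  qed
next
  assume rigid: "rigid (join_irreducibles :: 'a set)"
  show "rigid (UNIV :: 'a set)"
    unfolding rigid_def poset_automorphism_iff_isomorphism
  proof (intro allI impI ballI)
    fix f :: "'a \<Rightarrow> 'a" and x :: 'a
    assume f: "poset_isomorphism UNIV UNIV f"
    then have "f j = j" if "j \<in> join_irreducibles" for j
      using rigid that poset_isomorphism_restrict_join_irreducibles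
      by (auto simp: rigid_def poset_automorphism_iff_isomorphism)
    then have "f = id"
      using f by (intro poset_isomorphism_eqI_join_irreducibles)
        (auto simp: poset_isomorphism_def)
    then show "f x = x"
      by simp
  qed
qed

theorem theorem3p7:
  "distinguishing_number (UNIV :: 'a::{finite, distrib_lattice} set) = 1 \<longleftrightarrow>
   distinguishing_number (join_irreducibles :: 'a set) = 1"
  by (simp only: distinguishing_number_eq_1_iff_rigid[OF finite]
      rigid_UNIV_iff_rigid_join_irreducibles)

end
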